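(* Let $\Omega=(x_i,x_f)\subseteq\mathbb R$ be an open interval (bounded or unbounded) and let $f,h$ be probability density functions on $\mathbb R$, both supported on $\overline\Omega$ and positive on $\Omega$. For $r>0$ let $f_{(r)}(x)=rf(rx)$ and $h_{(r)}(x)=rh(rx)$. Then, for every $r>0$: (i) if $f,h$ are differentiable on $\Omega$, $p>1$ and $\lambda\neq0$, then $\phi_{p,\lambda}[f_{(r)}\|h_{(r)}]=\phi_{p,\lambda}[f\|h]$; (ii) if $p>0$ and $\lambda\in\mathbb R\setminus\{0\}$, then $\sigma_{p,\lambda}[f_{(r)}\|h_{(r)}]=\sigma_{p,\lambda}[f\|h]$.
   Context: Relative Fisher divergence, for densities on a common support interval $\Omega$: $\phi_{p,\lambda}[f\|h]=\Big(\int_\Omega f^{1+p(\lambda-1)}h^{-\lambda p}\big|\frac d{dx}\log\frac fh\big|^p\,dx\Big)^{1/(p\lambda)}$. Relative cumulative moment, for densities on a common support interval $\Omega=(x_i,x_f)$: $\mu_{p,\alpha}[f\|h]=\int_\Omega\Big|\int_{x_i}^xf(s)^{1-\alpha}h(s)^\alpha\,ds\Big|^pf(x)\,dx$ and $\sigma_{p,\alpha}[f\|h]=\mu_{p,\alpha}[f\|h]^{1/(p\alpha)}$. The scaled densities $f_{(r)},h_{(r)}$ have common support interval $(x_i/r,x_f/r)$. Values in $[0,\infty]$ are allowed, with the usual conventions for powers of $0$ and $\infty$. *)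

theory Defs
  imports "HOL-Analysis.Analysis"
begin

text \<open>
  Real powers on the extended nonnegative reals, with the conventions
  \<open>0\<^sup>q = 0\<close>, \<open>\<infinity>\<^sup>q = \<infinity>\<close> for \<open>q > 0\<close> and \<open>0\<^sup>q = \<infinity>\<close>, \<open>\<infinity>\<^sup>q = 0\<close> for \<open>q < 0\<close>.
  (Note that \<open>powr\<close> on the reals has \<open>0 powr q = 0\<close> for every \<open>q\<close>.)
\<close>

definition ennpow :: "ennreal \<Rightarrow> real \<Rightarrow> ennreal" where
  "ennpow a q =
     (if q = 0 then 1
      else if a = 0 then (if q < 0 then \<infinity> else 0)
      else if a = \<infinity> then (if q < 0 then 0 else \<infinity>)
      else ennreal (enn2real a powr q))"

definition density_on :: "ereal \<Rightarrow> ereal \<Rightarrow> (real \<Rightarrow> real) \<Rightarrow> bool" where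
  "density_on xi xf f \<longleftrightarrow>
     f \<in> borel_measurable lebesgue \<and>
     (\<forall>x. 0 \<le> f x) \<and>
     (\<integral>\<^sup>+x. ennreal (f x) \<partial>lebesgue) = 1 \<and>
     (\<forall>x. x \<notin> closure (einterval xi xf) \<longrightarrow> f x = 0) \<and>
     (\<forall>x \<in> einterval xi xf. 0 < f x)"

definition scaled :: "real \<Rightarrow> (real \<Rightarrow> real) \<Rightarrow> real \<Rightarrow> real" where
  "scaled r f = (\<lambda>x. r * f (r * x))"

text \<open>
  The functionals below take the end points of the common support interval of \<open>f\<close> and \<open>h\<close>
  as explicit arguments. Their integrands are nonnegative, and their values lie in \<open>[0,\<infinity>]\<close>.
\<close>

definition fisher_divergence ::
  "ereal \<Rightarrow> ereal \<Rightarrow> real \<Rightarrow> real \<Rightarrow> (real \<Rightarrow> real) \<Rightarrow> (real \<Rightarrow> real) \<Rightarrow> ennreal" where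
  "fisher_divergence xi xf p l f h =
     ennpow
       (\<integral>\<^sup>+x\<in>einterval xi xf.
          ennreal (f x powr (1 + p * (l - 1)) * h x powr (- (l * p))
                   * \<bar>deriv (\<lambda>y. ln (f y / h y)) x\<bar> powr p) \<partial>lebesgue)
       (1 / (p * l))"

text \<open>
  The inner integral may be infinite, hence its power is taken in the extended sense; it is
  nonnegative, so its absolute value is omitted.
\<close>

definition cumulative_moment ::
  "ereal \<Rightarrow> ereal \<Rightarrow> real \<Rightarrow> real \<Rightarrow> (real \<Rightarrow> real) \<Rightarrow> (real \<Rightarrow> real) \<Rightarrow> ennreal" where
  "cumulative_moment xi xf p a f h =
     (\<integral>\<^sup>+x\<in>einterval xi xf.
        ennpow (\<integral>\<^sup>+s\<in>einterval xi (ereal x). ennreal (f s powr (1 - a) * h s powr a) \<partial>lebesgue) p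
        * ennreal (f x) \<partial>lebesgue)"

definition cumulative_deviation ::
  "ereal \<Rightarrow> ereal \<Rightarrow> real \<Rightarrow> real \<Rightarrow> (real \<Rightarrow> real) \<Rightarrow> (real \<Rightarrow> real) \<Rightarrow> ennreal" where
  "cumulative_deviation xi xf p a f h = ennpow (cumulative_moment xi xf p a f h) (1 / (p * a))"

lemma einterval_scaled:
  assumes "r > 0"
  shows "x \<in> einterval (xi / ereal r) (xf / ereal r) \<longleftrightarrow> r * x \<in> einterval xi xf"
proof -
  have "xi / ereal r < ereal x \<longleftrightarrow> xi < ereal (r * x)"
    using assms by (cases xi) (auto simp: field_simps)
  moreover have "ereal x < xf / ereal r \<longleftrightarrow> ereal (r * x) < xf"
    using assms by (cases xf) (auto simp: field_simps)
  ultimately show ?thesis by (simp add: einterval_iff)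
qed

text \<open>The scaled densities are densities with support interval \<open>(xi/r, xf/r)\<close>.\<close>

lemma density_on_scaled:
  assumes r: "r > 0" and f: "density_on xi xf f"
  shows "density_on (xi / ereal r) (xf / ereal r) (scaled r f)"
proof -
  have meas: "f \<in> borel_measurable lebesgue" and int: "(\<integral>\<^sup>+x. ennreal (f x) \<partial>lebesgue) = 1"
    using f by (auto simp: density_on_def)
  have sc: "(\<lambda>x. r * x) \<in> lebesgue \<rightarrow>\<^sub>M (lebesgue :: real measure)"
    using lebesgue_measurable_scaling[of r, where 'a = real] unfolding real_scaleR_def .
  have m1: "(\<lambda>x. f (r * x)) \<in> borel_measurable lebesgue"
    using measurable_compose[OF sc meas] .
  have "(\<integral>\<^sup>+x. ennreal (f x) \<partial>lebesgue) = ennreal r * (\<integral>\<^sup>+x. ennreal (f (r * x)) \<partial>lebesgue)"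
    using nn_integral_real_affine_lebesgue[of "\<lambda>x. ennreal (f x)" r 0] meas r by simp
  also have "\<dots> = (\<integral>\<^sup>+x. ennreal r * ennreal (f (r * x)) \<partial>lebesgue)"
    using m1 by (subst nn_integral_cmult) auto
  also have "\<dots> = (\<integral>\<^sup>+x. ennreal (scaled r f x) \<partial>lebesgue)"
    using r f by (intro nn_integral_cong) (simp add: scaled_def density_on_def ennreal_mult)
  finally have int': "(\<integral>\<^sup>+x. ennreal (scaled r f x) \<partial>lebesgue) = 1"
    using int by simp
  have img: "(\<lambda>x. r *\<^sub>R x) ` einterval (xi / ereal r) (xf / ereal r) = einterval xi xf"
  proof (intro set_eqI iffI)
    fix y assume "y \<in> einterval xi xf"
    then have "y / r \<in> einterval (xi / ereal r) (xf / ereal r)"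
      using r by (simp add: einterval_scaled)
    then show "y \<in> (\<lambda>x. r *\<^sub>R x) ` einterval (xi / ereal r) (xf / ereal r)"
      using r by (intro image_eqI[of _ _ "y / r"]) auto
  qed (use r in \<open>auto simp: einterval_scaled\<close>)
  have cl: "r * x \<in> closure (einterval xi xf) \<longleftrightarrow>
            x \<in> closure (einterval (xi / ereal r) (xf / ereal r))" for x
  proof -
    have "closure (einterval xi xf) =
          (\<lambda>x. r *\<^sub>R x) ` closure (einterval (xi / ereal r) (xf / ereal r))"
      using closure_scaleR[of r "einterval (xi / ereal r) (xf / ereal r)"] unfolding img by simp
    moreover have "inj ((*\<^sub>R) r :: real \<Rightarrow> real)"
      using r by (simp add: inj_on_def)
    ultimately show ?thesis
      using inj_image_mem_iff by fastforce
  qed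
  show ?thesis
    unfolding density_on_def
    using r f m1 int' cl by (auto simp: density_on_def scaled_def einterval_scaled)
qed

end

theory Submission
  imports Defs
begin

text \<open>
  Both integrands are homogeneous of degree one under the scaling: the integrand for the scaled
  densities at \<open>x\<close> is \<open>r\<close> times the original one at \<open>r * x\<close>. The substitution \<open>y = r * x\<close> then
  shows that the integrals agree before the outer power is taken. The substitution rule is proved
  for arbitrary functions, so that the integrands need not be shown measurable.
\<close>

text \<open>The integral of an arbitrary \<open>g\<close> is the supremum over the simple functions
  \<open>u\<close> below \<open>g\<close>. Each \<open>u\<close> is measurable, so the affine
  substitution rule applies to it, and monotonicity passes from \<open>u\<close> back to
  \<open>g\<close> on the right. This gives one inequality only, but for every positive factor,
  hence also for \<open>1 / r\<close>.\<close>

lemma nn_integral_lebesgue_scale_le: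
  fixes g :: "real \<Rightarrow> ennreal"
  assumes r: "r > 0"
  shows "(\<integral>\<^sup>+x. g x \<partial>lebesgue) \<le> ennreal r * (\<integral>\<^sup>+x. g (r * x) \<partial>lebesgue)"
  unfolding nn_integral_def[of lebesgue g]
proof (rule SUP_least, clarify)
  fix u :: "real \<Rightarrow> ennreal"
  assume u: "simple_function lebesgue u" and le: "u \<le> g"
  have meas: "u \<in> borel_measurable lebesgue"
    using u by (rule borel_measurable_simple_function)
  have "integral\<^sup>S lebesgue u = (\<integral>\<^sup>+x. u x \<partial>lebesgue)"
    using u by (simp add: nn_integral_eq_simple_integral)
  also have "\<dots> = ennreal r * (\<integral>\<^sup>+x. u (r * x) \<partial>lebesgue)"
    using nn_integral_real_affine_lebesgue[OF meas, of r 0] r by simp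
  also have "\<dots> \<le> ennreal r * (\<integral>\<^sup>+x. g (r * x) \<partial>lebesgue)"
    using le by (intro mult_left_mono nn_integral_mono) (auto simp: le_fun_def)
  finally show "integral\<^sup>S lebesgue u \<le> ennreal r * (\<integral>\<^sup>+x. g (r * x) \<partial>lebesgue)" .
qed

text \<open>Multiplication by \<open>c\<close> commutes with the supremum over simple functions
  \<open>u \<le> g\<close>, and \<open>c * u\<close> lies below \<open>c * g\<close>. For measurable
  \<open>u\<close> the constant can be pulled out of the integral with equality.\<close>

lemma nn_integral_cmult_le:
  fixes g :: "'a \<Rightarrow> ennreal" and c :: ennreal
  shows "c * (\<integral>\<^sup>+x. g x \<partial>M) \<le> (\<integral>\<^sup>+x. c * g x \<partial>M)"
  unfolding nn_integral_def[of M g] SUP_mult_left_ennreal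
proof (rule SUP_least, clarify)
  fix u :: "'a \<Rightarrow> ennreal"
  assume u: "simple_function M u" and le: "u \<le> g"
  have "c * integral\<^sup>S M u = (\<integral>\<^sup>+x. c * u x \<partial>M)"
    using u by (simp add: nn_integral_eq_simple_integral nn_integral_cmult
        borel_measurable_simple_function)
  also have "\<dots> \<le> (\<integral>\<^sup>+x. c * g x \<partial>M)"
    using le by (intro nn_integral_mono mult_left_mono) (auto simp: le_fun_def)
  finally show "c * integral\<^sup>S M u \<le> (\<integral>\<^sup>+x. c * g x \<partial>M)" .
qed

lemma nn_integral_lebesgue_scale:
  fixes g :: "real \<Rightarrow> ennreal"
  assumes r: "r > 0"
  shows "(\<integral>\<^sup>+x. ennreal r * g (r * x) \<partial>lebesgue) = (\<integral>\<^sup>+x. g x \<partial>lebesgue)"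
proof (rule antisym)
  have cancel: "ennreal (1 / r) * (ennreal r * c) = c" for c
    using r by (simp add: mult.assoc[symmetric] ennreal_mult[symmetric])
  \<comment> \<open>The one-sided rule is applied with the inverse factor \<open>1 / r\<close> to
    the rescaled function, which undoes the scaling of the argument. Moving \<open>1 / r\<close>
    under the integral then cancels the remaining \<open>r\<close>.\<close>
  have "(\<integral>\<^sup>+x. ennreal r * g (r * x) \<partial>lebesgue)
      \<le> ennreal (1 / r) * (\<integral>\<^sup>+x. ennreal r * g x \<partial>lebesgue)"
    using nn_integral_lebesgue_scale_le[of "1 / r" "\<lambda>x. ennreal r * g (r * x)"] r by simp
  also have "\<dots> \<le> (\<integral>\<^sup>+x. g x \<partial>lebesgue)"
    using nn_integral_cmult_le[of "ennreal (1 / r)" lebesgue "\<lambda>x. ennreal r * g x"]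
    by (simp only: cancel)
  finally show "(\<integral>\<^sup>+x. ennreal r * g (r * x) \<partial>lebesgue) \<le> (\<integral>\<^sup>+x. g x \<partial>lebesgue)" .
  show "(\<integral>\<^sup>+x. g x \<partial>lebesgue) \<le> (\<integral>\<^sup>+x. ennreal r * g (r * x) \<partial>lebesgue)"
    using nn_integral_lebesgue_scale_le[OF r, of g]
      nn_integral_cmult_le[of "ennreal r" lebesgue "\<lambda>x. g (r * x)"]
    by (rule order_trans)
qed

text \<open>The indicator of the shrunken interval at \<open>x\<close> is the indicator of the
  original one at \<open>r * x\<close>. The pointwise relation is asked for inside the interval
  only, because the Fisher integrand is shown to be homogeneous just where the densities are
  positive and differentiable.\<close>

lemma nn_integral_einterval_scale:
  fixes g g' :: "real \<Rightarrow> ennreal"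
  assumes r: "r > 0"
    and g': "\<And>x. r * x \<in> einterval a b \<Longrightarrow> g' x = ennreal r * g (r * x)"
  shows "(\<integral>\<^sup>+x\<in>einterval (a / ereal r) (b / ereal r). g' x \<partial>lebesgue)
       = (\<integral>\<^sup>+x\<in>einterval a b. g x \<partial>lebesgue)"
proof -
  have "(\<integral>\<^sup>+x\<in>einterval (a / ereal r) (b / ereal r). g' x \<partial>lebesgue)
      = (\<integral>\<^sup>+x. ennreal r * (g (r * x) * indicator (einterval a b) (r * x)) \<partial>lebesgue)"
    using r g' by (intro nn_integral_cong) (auto simp: einterval_scaled indicator_def)
  also have "\<dots> = (\<integral>\<^sup>+x\<in>einterval a b. g x \<partial>lebesgue)"
    using nn_integral_lebesgue_scale[OF r, of "\<lambda>x. g x * indicator (einterval a b) x"] .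
  finally show ?thesis .
qed

lemma deriv_scale_arg:
  fixes g :: "real \<Rightarrow> real"
  assumes "g differentiable (at (r * x))"
  shows "deriv (\<lambda>y. g (r * y)) x = r * deriv g (r * x)"
proof -
  have "(g has_field_derivative deriv g (r * x)) (at (r * x))"
    using assms by (simp add: DERIV_deriv_iff_real_differentiable)
  moreover have "((\<lambda>y. r * y) has_field_derivative r) (at x)"
    by (auto intro!: derivative_eq_intros)
  ultimately have "((\<lambda>y. g (r * y)) has_field_derivative deriv g (r * x) * r) (at x)"
    by (rule DERIV_chain2)
  then show ?thesis
    by (simp add: DERIV_imp_deriv mult.commute)
qed

lemma differentiable_ln_divide:
  fixes f h :: "real \<Rightarrow> real"
  assumes "f differentiable (at x)" "h differentiable (at x)" "f x > 0" "h x > 0"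
  shows "(\<lambda>y. ln (f y / h y)) differentiable (at x)"
proof -
  obtain f' h' where "(f has_real_derivative f') (at x)" "(h has_real_derivative h') (at x)"
    using assms real_differentiableE by metis
  then have "((\<lambda>y. f y / h y) has_real_derivative
              (f' * h x - f x * h') / (h x * h x)) (at x)"
    using assms by (intro DERIV_divide) auto
  then have "((\<lambda>y. ln (f y / h y)) has_real_derivative
              1 / (f x / h x) * ((f' * h x - f x * h') / (h x * h x))) (at x)"
    using assms by (intro DERIV_chain2[OF DERIV_ln_divide]) auto
  then show ?thesis
    by (auto simp: real_differentiable_def)
qed

lemma fisher_divergence_scaled:
  assumes f: "density_on xi xf f" and h: "density_on xi xf h" and r: "r > 0"
    and df: "\<And>x. x \<in> einterval xi xf \<Longrightarrow> f differentiable (at x)"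
    and dh: "\<And>x. x \<in> einterval xi xf \<Longrightarrow> h differentiable (at x)"
  shows "fisher_divergence (xi / ereal r) (xf / ereal r) p l (scaled r f) (scaled r h)
       = fisher_divergence xi xf p l f h"
  unfolding fisher_divergence_def
proof (rule arg_cong[where f = "\<lambda>c. ennpow c (1 / (p * l))"],
       rule nn_integral_einterval_scale[OF r])
  fix x assume x: "r * x \<in> einterval xi xf"
  have pos: "f (r * x) > 0" "h (r * x) > 0"
    using f h x by (auto simp: density_on_def)
  let ?D = "deriv (\<lambda>y. ln (f y / h y)) (r * x)"
  \<comment> \<open>The prefactors cancel in the quotient, so the log-ratio is merely composed with
    \<open>y \<mapsto> r * y\<close>, and the chain rule contributes a single factor
    \<open>r\<close>.\<close>
  have ratio: "scaled r f y / scaled r h y = f (r * y) / h (r * y)" for y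
    using r by (simp add: scaled_def)
  have D: "deriv (\<lambda>y. ln (scaled r f y / scaled r h y)) x = r * ?D"
    unfolding ratio
    by (rule deriv_scale_arg[OF differentiable_ln_divide[OF df[OF x] dh[OF x] pos]])
  have "scaled r f x powr (1 + p * (l - 1)) * scaled r h x powr (- (l * p)) * \<bar>r * ?D\<bar> powr p
     = (r powr (1 + p * (l - 1)) * r powr (- (l * p)) * r powr p)
     * (f (r * x) powr (1 + p * (l - 1)) * h (r * x) powr (- (l * p)) * \<bar>?D\<bar> powr p)"
    using r pos by (simp add: scaled_def powr_mult abs_mult)
  \<comment> \<open>The exponents add up to \<open>1 + p * (l - 1) - l * p + p = 1\<close>: the
    factor from the derivative, raised to \<open>p\<close>, restores exactly what the two densities
    lack.\<close>
  also have "r powr (1 + p * (l - 1)) * r powr (- (l * p)) * r powr p = r"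
    using r by (simp add: powr_add[symmetric] algebra_simps)
  finally show "ennreal (scaled r f x powr (1 + p * (l - 1)) * scaled r h x powr (- (l * p))
         * \<bar>deriv (\<lambda>y. ln (scaled r f y / scaled r h y)) x\<bar> powr p)
     = ennreal r * ennreal (f (r * x) powr (1 + p * (l - 1)) * h (r * x) powr (- (l * p))
         * \<bar>?D\<bar> powr p)"
    unfolding D using r by (simp add: ennreal_mult)
qed

lemma cumulative_moment_scaled:
  assumes f: "\<And>x. f x \<ge> 0" and h: "\<And>x. h x \<ge> 0" and r: "r > 0"
  shows "cumulative_moment (xi / ereal r) (xf / ereal r) p a (scaled r f) (scaled r h)
       = cumulative_moment xi xf p a f h"
  unfolding cumulative_moment_def
proof (rule nn_integral_einterval_scale[OF r])
  fix x
  \<comment> \<open>The inner integral for the scaled densities up to \<open>x\<close> equals the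
    original one up to \<open>r * x\<close>, since the weights \<open>1 - a\<close> and
    \<open>a\<close> sum to one. So no power of \<open>r\<close> leaves \<open>ennpow\<close>; the
    single factor \<open>r\<close> of the outer integrand comes from the density
    \<open>scaled r f x\<close>. The upper limit is written as a quotient to match the substitution
    rule.\<close>
  have "(\<integral>\<^sup>+s\<in>einterval (xi / ereal r) (ereal (r * x) / ereal r).
           ennreal (scaled r f s powr (1 - a) * scaled r h s powr a) \<partial>lebesgue)
      = (\<integral>\<^sup>+s\<in>einterval xi (ereal (r * x)). ennreal (f s powr (1 - a) * h s powr a) \<partial>lebesgue)"
  proof (rule nn_integral_einterval_scale[OF r])
    fix s
    have "scaled r f s powr (1 - a) * scaled r h s powr a
        = (r powr (1 - a) * r powr a) * (f (r * s) powr (1 - a) * h (r * s) powr a)"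
      using r f h by (simp add: scaled_def powr_mult)
    also have "r powr (1 - a) * r powr a = r"
      using r by (simp add: powr_add[symmetric])
    finally show "ennreal (scaled r f s powr (1 - a) * scaled r h s powr a)
        = ennreal r * ennreal (f (r * s) powr (1 - a) * h (r * s) powr a)"
      using r by (simp add: ennreal_mult)
  qed
  moreover have "ereal (r * x) / ereal r = ereal x"
    using r by simp
  ultimately show "ennpow (\<integral>\<^sup>+s\<in>einterval (xi / ereal r) (ereal x).
             ennreal (scaled r f s powr (1 - a) * scaled r h s powr a) \<partial>lebesgue) p
           * ennreal (scaled r f x)
      = ennreal r * (ennpow (\<integral>\<^sup>+s\<in>einterval xi (ereal (r * x)).
             ennreal (f s powr (1 - a) * h s powr a) \<partial>lebesgue) p * ennreal (f (r * x)))"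
    using r f by (simp add: scaled_def ennreal_mult mult_ac)
qed

theorem lemma4p2:
  fixes xi xf :: ereal and f h :: "real \<Rightarrow> real" and r :: real
  assumes "xi < xf"
    and "density_on xi xf f" and "density_on xi xf h"
    and "r > 0"
  shows
    "(\<forall>p l :: real.
        (\<forall>x \<in> einterval xi xf. f differentiable (at x)) \<and>
        (\<forall>x \<in> einterval xi xf. h differentiable (at x)) \<and> p > 1 \<and> l \<noteq> 0 \<longrightarrow>
        fisher_divergence (xi / ereal r) (xf / ereal r) p l (scaled r f) (scaled r h)
          = fisher_divergence xi xf p l f h) \<and>
     (\<forall>p l :: real. p > 0 \<and> l \<noteq> 0 \<longrightarrow>
        cumulative_deviation (xi / ereal r) (xf / ereal r) p l (scaled r f) (scaled r h)
          = cumulative_deviation xi xf p l f h)"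
  using assms
  by (auto simp: cumulative_deviation_def density_on_def
      intro!: fisher_divergence_scaled cumulative_moment_scaled
        arg_cong[where f = "\<lambda>c. ennpow c q" for q])

end
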